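(* If $n\ge 4$ is an even integer, then $\chi(Q_{n}^{[\natural n-2]})\le \chi(J(n,n/2,1))+2$.
   Context: $Q_n^{[\natural p]}$ is the graph on $\{0,1\}^n$ in which two vertices are adjacent iff they differ in exactly $p$ coordinates. For integers $i\le k\le n$, the generalized Johnson graph $J(n,k,i)$ has vertex set $\{A\subseteq\{1,\ldots,n\}: |A|=k\}$ and edge set $\{AB: |A\cap B|=i\}$. $\chi$ denotes the chromatic number. *)

theory Defs
  imports Main "HOL-Library.FuncSet"
begin

text \<open>
  A finite simple graph is a pair of a vertex set and a set of edges, each edge being an
  unordered pair (a two-element set) of vertices.
\<close>

type_synonym 'a graph = "'a set \<times> 'a set set"

abbreviation verts :: "'a graph \<Rightarrow> 'a set" where
  "verts G \<equiv> fst G"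

abbreviation edges :: "'a graph \<Rightarrow> 'a set set" where
  "edges G \<equiv> snd G"

definition simple_graph :: "'a graph \<Rightarrow> bool" where
  "simple_graph G \<longleftrightarrow> finite (verts G) \<and> (\<forall>e\<in>edges G. e \<subseteq> verts G \<and> card e = 2)"

definition proper_colouring :: "'a graph \<Rightarrow> nat \<Rightarrow> ('a \<Rightarrow> nat) \<Rightarrow> bool" where
  "proper_colouring G k c \<longleftrightarrow>
     (\<forall>v\<in>verts G. c v < k) \<and> (\<forall>u v. {u, v} \<in> edges G \<longrightarrow> c u \<noteq> c v)"

definition chromatic_number :: "'a graph \<Rightarrow> nat" ("\<chi>'(_')") where
  "\<chi>(G) = (LEAST k. \<exists>c. proper_colouring G k c)"

text \<open>The minimum is attained for every finite simple graph, so \<open>LEAST\<close> is never a junk value.\<close>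

lemma chromatic_number_attained:
  assumes "simple_graph G"
  shows "\<exists>c. proper_colouring G \<chi>(G) c"
proof -
  have fin: "finite (verts G)"
    and edge: "\<And>e. e \<in> edges G \<Longrightarrow> e \<subseteq> verts G \<and> card e = 2"
    using assms by (auto simp: simple_graph_def)
  obtain c :: "'a \<Rightarrow> nat" where c: "bij_betw c (verts G) {0..<card (verts G)}"
    using ex_bij_betw_finite_nat[OF fin] by blast
  have "c u \<noteq> c v" if "{u, v} \<in> edges G" for u v
  proof -
    have "u \<in> verts G" "v \<in> verts G" "u \<noteq> v"
      using edge[OF that] by (auto simp: card_2_iff)
    then show ?thesis
      using c by (auto simp: bij_betw_def inj_on_def)
  qed
  moreover have "\<forall>v\<in>verts G. c v < card (verts G)"
    using c by (auto simp: bij_betw_def)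
  ultimately have "\<exists>k c. proper_colouring G k c"
    unfolding proper_colouring_def by blast
  then show ?thesis
    unfolding chromatic_number_def by (rule LeastI_ex)
qed

text \<open>
  The graph $Q_n^{[\natural p]}$: points of $\{0,1\}^n$ are extensional functions on
  \<open>{1..n}\<close>; two points are joined iff their Hamming distance is exactly \<open>p\<close>.
\<close>

definition cube_exact_distance_graph :: "nat \<Rightarrow> nat \<Rightarrow> (nat \<Rightarrow> nat) graph" where
  "cube_exact_distance_graph n p =
     (let V = {1..n} \<rightarrow>\<^sub>E {0, 1}
      in (V, {{x, y} | x y. x \<in> V \<and> y \<in> V \<and> x \<noteq> y \<and> card {j \<in> {1..n}. x j \<noteq> y j} = p}))"

definition johnson_graph :: "nat \<Rightarrow> nat \<Rightarrow> nat \<Rightarrow> nat set graph" where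
  "johnson_graph n k i =
     (let V = {A. A \<subseteq> {1..n} \<and> card A = k}
      in (V, {{A, B} | A B. A \<in> V \<and> B \<in> V \<and> A \<noteq> B \<and> card (A \<inter> B) = i}))"

lemma simple_graph_pairs:
  assumes "finite V"
  shows "simple_graph (V, {{x, y} | x y. x \<in> V \<and> y \<in> V \<and> x \<noteq> y \<and> P x y})"
proof -
  have "e \<subseteq> V \<and> card e = 2" if "e \<in> {{x, y} | x y. x \<in> V \<and> y \<in> V \<and> x \<noteq> y \<and> P x y}" for e
  proof -
    obtain x y where "e = {x, y}" "x \<in> V" "y \<in> V" "x \<noteq> y"
      using \<open>e \<in> _\<close> by blast
    then show ?thesis by simp
  qed
  then show ?thesis
    unfolding simple_graph_def using assms by simp
qed

lemma simple_graph_cube_exact_distance_graph: "simple_graph (cube_exact_distance_graph n p)"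
  unfolding cube_exact_distance_graph_def Let_def
  by (rule simple_graph_pairs) (simp add: finite_PiE)

lemma simple_graph_johnson_graph: "simple_graph (johnson_graph n k i)"
  unfolding johnson_graph_def Let_def
  by (rule simple_graph_pairs) simp

end

theory Submission
  imports Defs
begin

text \<open>
  Identify points of the cube with subsets of \<open>{1..n}\<close>, where \<open>n = 2m\<close>. Adjacent sets have
  sizes of equal parity, and toggling the element 1 exchanges the two parity classes while
  preserving symmetric differences, so only sets whose size has the parity of \<open>m\<close> need to be
  coloured. If \<open>A\<close> and \<open>B\<close> have symmetric difference of size \<open>2m - 2\<close>, then
  \<open>2m - 2 \<le> |A| + |B| \<le> 2m + 2\<close>. So the sets of size at most \<open>m - 2\<close> are independent, and so
  are those of size at least \<open>m + 2\<close>; the remaining sets have size \<open>m\<close> and induce \<open>J(n, m, 1)\<close>.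
\<close>

lemma chromatic_number_le:
  assumes "proper_colouring G k c"
  shows "\<chi>(G) \<le> k"
  unfolding chromatic_number_def using assms by (auto intro: Least_le)

definition graph_homomorphism :: "'a graph \<Rightarrow> 'b graph \<Rightarrow> ('a \<Rightarrow> 'b) \<Rightarrow> bool" where
  "graph_homomorphism G H f \<longleftrightarrow>
     f ` verts G \<subseteq> verts H \<and> (\<forall>u v. {u, v} \<in> edges G \<longrightarrow> {f u, f v} \<in> edges H)"

lemma chromatic_number_le_if_homomorphism:
  assumes "graph_homomorphism G H f" and "simple_graph H"
  shows "\<chi>(G) \<le> \<chi>(H)"
proof -
  obtain c where "proper_colouring H \<chi>(H) c"
    using chromatic_number_attained[OF assms(2)] by blast
  then have "proper_colouring G \<chi>(H) (c \<circ> f)"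
    using assms(1) by (fastforce simp: proper_colouring_def graph_homomorphism_def)
  then show ?thesis
    by (rule chromatic_number_le)
qed

definition independent_set :: "'a graph \<Rightarrow> 'a set \<Rightarrow> bool" where
  "independent_set G I \<longleftrightarrow> (\<forall>u\<in>I. \<forall>v\<in>I. {u, v} \<notin> edges G)"

definition delete_verts :: "'a graph \<Rightarrow> 'a set \<Rightarrow> 'a graph" where
  "delete_verts G S = (verts G - S, {e \<in> edges G. e \<inter> S = {}})"

lemma simple_graph_delete_verts:
  assumes "simple_graph G"
  shows "simple_graph (delete_verts G S)"
  using assms by (auto simp: simple_graph_def delete_verts_def)

lemma chromatic_number_le_delete_independent_set:
  assumes "simple_graph G" and "independent_set G I"
  shows "\<chi>(G) \<le> \<chi>(delete_verts G I) + 1"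
proof -
  define k where "k = \<chi>(delete_verts G I)"
  obtain c where c: "proper_colouring (delete_verts G I) k c"
    using chromatic_number_attained[OF simple_graph_delete_verts[OF assms(1)]]
    unfolding k_def by blast
  define c' where "c' v = (if v \<in> I then k else c v)" for v
  have old_colour: "c v < k" if "v \<in> verts G - I" for v
    using c that by (simp add: proper_colouring_def delete_verts_def)
  have "c' u \<noteq> c' v" if edge: "{u, v} \<in> edges G" for u v
  proof -
    have ends: "u \<in> verts G" "v \<in> verts G"
      using assms(1) edge by (auto simp: simple_graph_def)
    consider (left) "u \<in> I" "v \<notin> I" | (right) "u \<notin> I" "v \<in> I"
      | (neither) "u \<notin> I" "v \<notin> I"
      using assms(2) edge by (auto simp: independent_set_def)
    then show ?thesis
    proof cases
      case neither
      then have "{u, v} \<in> edges (delete_verts G I)"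
        using edge by (simp add: delete_verts_def)
      then show ?thesis
        using c neither by (simp add: proper_colouring_def c'_def)
    qed (use old_colour[of u] old_colour[of v] ends in \<open>auto simp: c'_def\<close>)
  qed
  moreover have "c' v < k + 1" if "v \<in> verts G" for v
    using old_colour[of v] that by (auto simp: c'_def)
  ultimately have "proper_colouring G (k + 1) c'"
    by (simp add: proper_colouring_def)
  then show ?thesis
    unfolding k_def by (rule chromatic_number_le)
qed

lemma card_sym_diff_add_Int:
  assumes "finite A" and "finite B"
  shows "card (sym_diff A B) + 2 * card (A \<inter> B) = card A + card B"
proof -
  have "card (sym_diff A B) = card (A - B) + card (B - A)"
    using assms by (intro card_Un_disjoint) auto
  moreover have "card A = card (A - B) + card (A \<inter> B)"
    using card_Int_Diff[OF assms(1), of B] by simp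
  moreover have "card B = card (B - A) + card (A \<inter> B)"
    using card_Int_Diff[OF assms(2), of A] by (simp add: Int_commute)
  ultimately show ?thesis by simp
qed

lemma card_add_card_sym_diff:
  assumes "finite A" and "finite B"
  shows "card A + card B + card (sym_diff A B) = 2 * card (A \<union> B)"
  using card_sym_diff_add_Int[OF assms] card_Un_Int[OF assms] by simp

lemma even_card_sym_diff_iff:
  assumes "finite A" and "finite B"
  shows "even (card (sym_diff A B)) \<longleftrightarrow> even (card A) = even (card B)"
proof -
  have "even (card (sym_diff A B) + 2 * card (A \<inter> B)) \<longleftrightarrow> even (card A + card B)"
    using card_sym_diff_add_Int[OF assms] by simp
  then show ?thesis by simp
qed

definition set_distance_graph :: "'a set set \<Rightarrow> nat \<Rightarrow> 'a set graph" where
  "set_distance_graph \<F> p =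
     (\<F>, {{A, B} | A B. A \<in> \<F> \<and> B \<in> \<F> \<and> A \<noteq> B \<and> card (sym_diff A B) = p})"

lemma verts_set_distance_graph [simp]: "verts (set_distance_graph \<F> p) = \<F>"
  by (simp add: set_distance_graph_def)

lemma in_edges_set_distance_graph_iff:
  "{A, B} \<in> edges (set_distance_graph \<F> p) \<longleftrightarrow>
     A \<in> \<F> \<and> B \<in> \<F> \<and> A \<noteq> B \<and> card (sym_diff A B) = p"
  by (auto simp: set_distance_graph_def doubleton_eq_iff Un_commute)

lemma simple_graph_set_distance_graph:
  assumes "finite \<F>"
  shows "simple_graph (set_distance_graph \<F> p)"
  unfolding set_distance_graph_def using assms by (rule simple_graph_pairs)

lemma chromatic_number_set_distance_graph_le_Diff:
  assumes "finite \<F>" and "independent_set (set_distance_graph \<F> p) \<S>"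
  shows "\<chi>(set_distance_graph \<F> p) \<le> \<chi>(set_distance_graph (\<F> - \<S>) p) + 1"
proof -
  have "delete_verts (set_distance_graph \<F> p) \<S> = set_distance_graph (\<F> - \<S>) p"
    unfolding delete_verts_def set_distance_graph_def by auto
  then show ?thesis
    using chromatic_number_le_delete_independent_set
      [OF simple_graph_set_distance_graph[OF assms(1)] assms(2)] by simp
qed

lemma independent_set_small_sets:
  assumes "\<And>A. A \<in> \<F> \<Longrightarrow> finite A"
  shows "independent_set (set_distance_graph \<F> p) {A. 2 * card A < p}"
  unfolding independent_set_def
proof (intro ballI notI)
  fix A B
  assume small: "A \<in> {A. 2 * card A < p}" "B \<in> {A. 2 * card A < p}"
    and "{A, B} \<in> edges (set_distance_graph \<F> p)"
  then have "finite A" "finite B" and "card (sym_diff A B) = p"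
    using assms by (auto simp: in_edges_set_distance_graph_iff)
  then have "p \<le> card A + card B"
    using card_sym_diff_add_Int[of A B] by simp
  then show False
    using small by simp
qed

lemma independent_set_large_sets:
  assumes "finite X" and "\<F> \<subseteq> Pow X"
  shows "independent_set (set_distance_graph \<F> p) {A. 2 * card A + p > 2 * card X}"
  unfolding independent_set_def
proof (intro ballI notI)
  fix A B
  assume large: "A \<in> {A. 2 * card A + p > 2 * card X}" "B \<in> {A. 2 * card A + p > 2 * card X}"
    and "{A, B} \<in> edges (set_distance_graph \<F> p)"
  then have sub: "A \<subseteq> X" "B \<subseteq> X" and dist: "card (sym_diff A B) = p"
    using assms(2) by (auto simp: in_edges_set_distance_graph_iff)
  then have "finite A" "finite B"
    using assms(1) finite_subset by blast+
  then have "card A + card B + p = 2 * card (A \<union> B)"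
    using card_add_card_sym_diff dist by blast
  also have "\<dots> \<le> 2 * card X"
    using sub assms(1) by (simp add: card_mono)
  finally show False
    using large by simp
qed

lemma chromatic_number_set_distance_graph_le_middle_layers:
  assumes "finite X" and "\<F> \<subseteq> Pow X"
  shows "\<chi>(set_distance_graph \<F> p) \<le>
    \<chi>(set_distance_graph {A \<in> \<F>. p \<le> 2 * card A \<and> 2 * card A + p \<le> 2 * card X} p) + 2"
proof -
  let ?small = "{A. 2 * card A < p}" and ?large = "{A. 2 * card A + p > 2 * card X}"
  have fin: "finite \<F>" "\<And>A. A \<in> \<F> \<Longrightarrow> finite A"
    using assms by (auto intro: finite_subset)
  have "\<chi>(set_distance_graph \<F> p) \<le> \<chi>(set_distance_graph (\<F> - ?small) p) + 1"
    using fin by (intro chromatic_number_set_distance_graph_le_Diff independent_set_small_sets)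
  also have "\<chi>(set_distance_graph (\<F> - ?small) p) \<le>
      \<chi>(set_distance_graph (\<F> - ?small - ?large) p) + 1"
    using assms fin(1)
    by (intro chromatic_number_set_distance_graph_le_Diff independent_set_large_sets) auto
  also have "\<F> - ?small - ?large = {A \<in> \<F>. p \<le> 2 * card A \<and> 2 * card A + p \<le> 2 * card X}"
    by auto
  finally show ?thesis by simp
qed

lemma chromatic_number_cube_le_Pow:
  "\<chi>(cube_exact_distance_graph n p) \<le> \<chi>(set_distance_graph (Pow {1..n}) p)"
proof (rule chromatic_number_le_if_homomorphism)
  define supp where "supp x = {j \<in> {1..n}. x j = (1::nat)}" for x
  have supp_subset: "supp x \<subseteq> {1..n}" for x
    by (auto simp: supp_def)
  have supp_edge: "{supp x, supp y} \<in> edges (set_distance_graph (Pow {1..n}) p)"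
    if xy: "x \<in> {1..n} \<rightarrow>\<^sub>E {0, 1}" "y \<in> {1..n} \<rightarrow>\<^sub>E {0, 1}" and "x \<noteq> y"
      and dist: "card {j \<in> {1..n}. x j \<noteq> y j} = p" for x y
  proof -
    have "x j = 0 \<or> x j = 1" "y j = 0 \<or> y j = 1" if "j \<in> {1..n}" for j
      using PiE_mem[OF xy(1) that] PiE_mem[OF xy(2) that] by auto
    then have sym_diff_supp: "sym_diff (supp x) (supp y) = {j \<in> {1..n}. x j \<noteq> y j}"
      by (fastforce simp: supp_def)
    obtain j where "j \<in> {1..n}" "x j \<noteq> y j"
      using PiE_ext[OF xy] \<open>x \<noteq> y\<close> by blast
    then have "supp x \<noteq> supp y"
      using sym_diff_supp by blast
    then show ?thesis
      unfolding in_edges_set_distance_graph_iff sym_diff_supp using supp_subset dist by simp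
  qed
  show "graph_homomorphism (cube_exact_distance_graph n p)
      (set_distance_graph (Pow {1..n}) p) supp"
    unfolding graph_homomorphism_def
  proof (intro conjI allI impI)
    show "supp ` verts (cube_exact_distance_graph n p) \<subseteq>
        verts (set_distance_graph (Pow {1..n}) p)"
      using supp_subset by auto
  next
    fix u v
    assume "{u, v} \<in> edges (cube_exact_distance_graph n p)"
    then obtain x y where "{u, v} = {x, y}" and "x \<in> {1..n} \<rightarrow>\<^sub>E {0, 1}"
      "y \<in> {1..n} \<rightarrow>\<^sub>E {0, 1}" "x \<noteq> y" "card {j \<in> {1..n}. x j \<noteq> y j} = p"
      by (auto simp: cube_exact_distance_graph_def Let_def)
    moreover from \<open>{u, v} = {x, y}\<close> have "{supp u, supp v} = {supp x, supp y}"
      by (metis image_empty image_insert)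
    ultimately show "{supp u, supp v} \<in> edges (set_distance_graph (Pow {1..n}) p)"
      using supp_edge by simp
  qed
qed (simp add: simple_graph_set_distance_graph)

definition parity_class :: "'a set \<Rightarrow> nat \<Rightarrow> 'a set set" where
  "parity_class X r = {A \<in> Pow X. even (card A) = even r}"

lemma chromatic_number_Pow_le_parity_class:
  assumes "finite X" and "a \<in> X" and "even p"
  shows "\<chi>(set_distance_graph (Pow X) p) \<le> \<chi>(set_distance_graph (parity_class X r) p)"
proof (rule chromatic_number_le_if_homomorphism)
  define toggle where
    "toggle A = (if even (card A) = even r then A else sym_diff A {a})" for A
  have toggle_mem: "toggle A \<in> parity_class X r" if "A \<subseteq> X" for A
    using even_card_sym_diff_iff[of A "{a}"] finite_subset[OF that assms(1)] that assms(2)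
    by (auto simp: toggle_def parity_class_def)
  have toggle_edge: "{toggle A, toggle B} \<in> edges (set_distance_graph (parity_class X r) p)"
    if edge: "{A, B} \<in> edges (set_distance_graph (Pow X) p)" for A B
  proof -
    have sub: "A \<subseteq> X" "B \<subseteq> X" and "A \<noteq> B" and dist: "card (sym_diff A B) = p"
      using edge by (auto simp: in_edges_set_distance_graph_iff)
    then have "even (card A) = even (card B)"
      using even_card_sym_diff_iff[of A B] finite_subset[OF _ assms(1)] assms(3) by simp
    then have "sym_diff (toggle A) (toggle B) = sym_diff A B"
      by (auto simp: toggle_def)
    moreover from this have "toggle A \<noteq> toggle B"
      using \<open>A \<noteq> B\<close> by blast
    ultimately show ?thesis
      using toggle_mem sub dist by (simp add: in_edges_set_distance_graph_iff)
  qed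
  show "graph_homomorphism (set_distance_graph (Pow X) p)
      (set_distance_graph (parity_class X r) p) toggle"
    using toggle_mem toggle_edge by (auto simp: graph_homomorphism_def)
  show "simple_graph (set_distance_graph (parity_class X r) p)"
    using assms(1) by (simp add: simple_graph_set_distance_graph parity_class_def)
qed

lemma johnson_graph_eq_set_distance_graph:
  assumes "i \<le> k"
  shows "johnson_graph n k i = set_distance_graph {A. A \<subseteq> {1..n} \<and> card A = k} (2 * (k - i))"
proof -
  have "card (A \<inter> B) = i \<longleftrightarrow> card (sym_diff A B) = 2 * (k - i)"
    if "A \<subseteq> {1..n}" "card A = k" "B \<subseteq> {1..n}" "card B = k" for A B :: "nat set"
  proof -
    have "finite A" "finite B"
      using that finite_subset by blast+
    then show ?thesis
      using card_sym_diff_add_Int[of A B] that assms by auto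
  qed
  then show ?thesis
    unfolding johnson_graph_def set_distance_graph_def Let_def by blast
qed

lemma middle_layers_of_parity_class:
  assumes "m \<ge> 1"
  shows "{A \<in> parity_class X m. 2 * m - 2 \<le> 2 * card A \<and> 2 * card A + (2 * m - 2) \<le> 4 * m} =
    {A. A \<subseteq> X \<and> card A = m}"
proof -
  have "c = m" if "even c = even m" "2 * m - 2 \<le> 2 * c" "2 * c + (2 * m - 2) \<le> 4 * m" for c
  proof -
    have "c = m - 1 \<or> c = m \<or> c = m + 1"
      using that(2,3) assms by linarith
    then show ?thesis
      using that(1) assms by auto
  qed
  then show ?thesis
    by (auto simp: parity_class_def)
qed

theorem theorem4p15:
  fixes n :: nat
  assumes "n \<ge> 4" and "even n"
  shows "\<chi>(cube_exact_distance_graph n (n - 2)) \<le> \<chi>(johnson_graph n (n div 2) 1) + 2"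
proof -
  obtain m where n: "n = 2 * m" and m: "m \<ge> 1"
    using assms by (auto elim: evenE)
  let ?\<F> = "parity_class {1..n} m"
  have "\<chi>(cube_exact_distance_graph n (n - 2)) \<le> \<chi>(set_distance_graph (Pow {1..n}) (n - 2))"
    by (rule chromatic_number_cube_le_Pow)
  also have "\<dots> \<le> \<chi>(set_distance_graph ?\<F> (n - 2))"
    using assms by (intro chromatic_number_Pow_le_parity_class[where a = 1]) auto
  also have "\<dots> \<le> \<chi>(set_distance_graph {A \<in> ?\<F>. n - 2 \<le> 2 * card A \<and>
      2 * card A + (n - 2) \<le> 2 * card {1..n}} (n - 2)) + 2"
    by (rule chromatic_number_set_distance_graph_le_middle_layers) (auto simp: parity_class_def)
  also have "{A \<in> ?\<F>. n - 2 \<le> 2 * card A \<and> 2 * card A + (n - 2) \<le> 2 * card {1..n}} =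
      {A. A \<subseteq> {1..n} \<and> card A = m}"
    using middle_layers_of_parity_class[OF m] n by simp
  also have "set_distance_graph \<dots> (n - 2) = johnson_graph n (n div 2) 1"
    using johnson_graph_eq_set_distance_graph[OF m, of n] n by (simp add: diff_mult_distrib2)
  finally show ?thesis .
qed

end
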